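(* Let $n\in\mathbb{N}$ ($n\ge1$), $\nu=1/(n+1)$, $\mu_j=j\,\nu$ for $j=1,\dots,n$, $\bar\mu=(\mu_1,\dots,\mu_n)$, and $\varphi_m(s)=(s/m)^m$. Then the Mellin convolution $e^{\star n}_{\bar\mu}(x,\varphi_{n+1}(t))$ is the density law of the $\nu$-stable subordinator $\{\tilde\tau^{(\nu)}_t,\ t>0\}$, that is, $$h_\nu(x,t)=e^{\star n}_{\bar\mu}(x,\varphi_{n+1}(t)),\qquad x>0,\ t>0.$$
   Context: For $\mu>0$, $e_\mu(x,t)=e^1_\mu(x,t)=\frac{t^{\mu}}{\Gamma(\mu)\,x^{\mu+1}}\exp\{-t/x\}$, $x,t>0$ (the density of the reciprocal Gamma variable). For $\bar\mu=(\mu_1,\dots,\mu_n)$ with $\mu_j>0$, the Mellin convolution is $e^{\star n}_{\bar\mu}(x,t)=e_{\mu_1}\star\cdots\star e_{\mu_n}(x,t)$, where $f_1\star f_2(x,t)=\int_0^\infty f_1(x,s)f_2(s,t)\,ds$; explicitly $e^{\star n}_{\bar\mu}(x,t)=\int_0^\infty\cdots\int_0^\infty e_{\mu_1}(x,s_1)e_{\mu_2}(s_1,s_2)\cdots e_{\mu_n}(s_{n-1},t)\,ds_1\cdots ds_{n-1}$, and $e^{\star1}_{\bar\mu}=e_{\mu_1}$. For $\nu\in(0,1)$, the $\nu$-stable subordinator $\{\tilde\tau^{(\nu)}_t,\ t>0\}$ is the non-decreasing Lévy process with $E\exp\{-\lambda\tilde\tau^{(\nu)}_t\}=\exp\{-t\lambda^\nu\}$,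 $t>0$, $\lambda>0$, and $h_\nu(\cdot,t)$ denotes the (continuous) density of $\tilde\tau^{(\nu)}_t$ on $(0,\infty)$. *)

theory Defs
  imports "HOL-Probability.Probability"
begin

definition recip_gamma_density :: "real \<Rightarrow> real \<Rightarrow> real \<Rightarrow> real" where
  "recip_gamma_density \<mu> x t = t powr \<mu> / (Gamma \<mu> * x powr (\<mu> + 1)) * exp (- t / x)"

definition mellin_conv :: "(real \<Rightarrow> real \<Rightarrow> real) \<Rightarrow> (real \<Rightarrow> real \<Rightarrow> real) \<Rightarrow> real \<Rightarrow> real \<Rightarrow> real"
  where "mellin_conv f g x t = (LBINT s:{0<..}. f x s * g s t)"

text \<open>The left-associated convolution \<open>(e\<^bsub>\<mu>1\<^esub> \<star> e\<^bsub>\<mu>2\<^esub>) \<star> \<dots> \<star> e\<^bsub>\<mu>n\<^esub>\<close> of a nonempty list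
  of parameters, so the iterated integral has \<open>s\<^sub>1\<close> innermost. The value on the empty list is
  meaningless.\<close>
definition recip_gamma_conv :: "real list \<Rightarrow> real \<Rightarrow> real \<Rightarrow> real" where
  "recip_gamma_conv \<mu>s =
     foldl mellin_conv (recip_gamma_density (hd \<mu>s)) (map recip_gamma_density (tl \<mu>s))"

definition \<phi> :: "nat \<Rightarrow> real \<Rightarrow> real" where
  "\<phi> m s = (s / real m) ^ m"

text \<open>Processes are indexed by \<open>real\<close>, but only the times \<open>t \<ge> 0\<close> matter. Path regularity is
  required in the weak form of stochastic continuity, not as cadlag paths.\<close>
locale levy_process = prob_space M for M :: "'w measure" +
  fixes X :: "real \<Rightarrow> 'w \<Rightarrow> real"
  assumes random_variable_at: "\<And>t. t \<ge> 0 \<Longrightarrow> random_variable borel (X t)"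
    and start_zero: "AE w in M. X 0 w = 0"
    and independent_increments:
      "\<And>(ts :: nat \<Rightarrow> real) k. 0 \<le> ts 0 \<Longrightarrow> mono ts \<Longrightarrow>
         indep_vars (\<lambda>_. borel) (\<lambda>i w. X (ts (Suc i)) w - X (ts i) w) {..<k}"
    and stationary_increments:
      "\<And>s t. s \<ge> 0 \<Longrightarrow> t \<ge> 0 \<Longrightarrow>
         distr M borel (\<lambda>w. X (s + t) w - X s w) = distr M borel (X t)"
    and stochastic_continuity:
      "\<And>t \<epsilon>. t \<ge> 0 \<Longrightarrow> \<epsilon> > 0 \<Longrightarrow>
         ((\<lambda>s. prob {w \<in> space M. \<bar>X s w - X t w\<bar> > \<epsilon>}) \<longlongrightarrow> 0) (at t within {0..})"

locale stable_subordinator = levy_process M \<tau> for M :: "'w measure" and \<tau> +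
  fixes \<nu> :: real
  assumes index: "0 < \<nu>" "\<nu> < 1"
    and nondecreasing: "AE w in M. \<forall>s t. 0 \<le> s \<longrightarrow> s \<le> t \<longrightarrow> \<tau> s w \<le> \<tau> t w"
    and laplace_transform:
      "\<And>t l. t > 0 \<Longrightarrow> l > 0 \<Longrightarrow>
         expectation (\<lambda>w. exp (- l * \<tau> t w)) = exp (- t * l powr \<nu>)"

text \<open>\<open>f\<close> is a continuous density of \<open>Y\<close> on \<open>(0, \<infinity>)\<close>; in particular \<open>Y\<close> is almost surely positive,
  and the values of \<open>f\<close> off \<open>(0, \<infinity>)\<close> are irrelevant.\<close>
definition continuous_density :: "'w measure \<Rightarrow> ('w \<Rightarrow> real) \<Rightarrow> (real \<Rightarrow> real) \<Rightarrow> bool" where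
  "continuous_density M Y f \<longleftrightarrow>
     (\<forall>x>0. f x \<ge> 0) \<and> continuous_on {0<..} f \<and>
     distributed M lborel Y (\<lambda>x. ennreal (indicator {0<..} x * f x))"

end

theory Submission imports Defs begin

text \<open>In the logarithmic coordinate \<open>u = ln (t / x)\<close> the Mellin convolution becomes the additive
  convolution of the functions \<open>G\<^sub>a u = exp (a u - exp u)\<close>, and the Laplace transform in \<open>x\<close> is
  the convolution with \<open>G\<^sub>0\<close>. So, up to the factor \<open>\<Prod>\<^sub>j Gamma (j \<nu>)\<close>, the Laplace transform is
  \<open>F = G\<^sub>0 * G\<^sub>\<nu> * \<dots> * G\<^bsub>n\<nu>\<^esub>\<close>. Since \<open>G\<^sub>0' = - G\<^sub>1\<close> and since multiplication by \<open>exp (\<nu> u)\<close>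
  shifts every index by \<open>\<nu>\<close>, with \<open>(n + 1) \<nu> = 1\<close>, commutativity gives
  \<open>F' u = - exp (\<nu> u) F u\<close> (Liouville). Hence \<open>F u = C exp (- exp (\<nu> u) / \<nu>)\<close>, which is the Laplace
  transform of the stable law, and a law on \<open>[0, \<infinity>)\<close> is determined by its Laplace transform.\<close>

section \<open>Additive convolution of nonnegative functions on the real line\<close>

text \<open>With values in \<open>ennreal\<close>, commutativity, associativity and multiplicativity
  of the total mass follow from Tonelli and changes of variable, without integrability
  conditions.\<close>

definition nn_conv :: "(real \<Rightarrow> ennreal) \<Rightarrow> (real \<Rightarrow> ennreal) \<Rightarrow> real \<Rightarrow> ennreal"
  where "nn_conv f g u = (\<integral>\<^sup>+v. f (u - v) * g v \<partial>lborel)"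

lemma borel_measurable_nn_conv [measurable]:
  assumes [measurable]: "f \<in> borel_measurable borel" "g \<in> borel_measurable borel"
  shows "nn_conv f g \<in> borel_measurable borel"
  unfolding nn_conv_def by measurable

lemma nn_integral_reflect:
  assumes [measurable]: "f \<in> borel_measurable borel"
  shows "(\<integral>\<^sup>+v. f (u - v) \<partial>lborel) = (\<integral>\<^sup>+v. f (v::real) \<partial>lborel)"
  using nn_integral_real_affine[of f "-1" u] by simp

lemma nn_integral_shift:
  assumes [measurable]: "f \<in> borel_measurable borel"
  shows "(\<integral>\<^sup>+v. f (v - u) \<partial>lborel) = (\<integral>\<^sup>+v. f (v::real) \<partial>lborel)"
  using nn_integral_real_affine[of f 1 "-u"] by simp

lemma nn_conv_commute:
  assumes [measurable]: "f \<in> borel_measurable borel" "g \<in> borel_measurable borel"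
  shows "nn_conv f g = nn_conv g f"
proof
  fix u
  show "nn_conv f g u = nn_conv g f u"
    unfolding nn_conv_def
    using nn_integral_reflect[of "\<lambda>v. f (u - v) * g v" u] by (simp add: mult.commute)
qed

lemma nn_conv_assoc:
  assumes [measurable]: "f \<in> borel_measurable borel" "g \<in> borel_measurable borel"
    "h \<in> borel_measurable borel"
  shows "nn_conv (nn_conv f g) h = nn_conv f (nn_conv g h)"
proof
  fix u
  have "nn_conv (nn_conv f g) h u = (\<integral>\<^sup>+v. (\<integral>\<^sup>+w. f (u - v - w) * g w * h v \<partial>lborel) \<partial>lborel)"
    unfolding nn_conv_def by (simp add: nn_integral_multc)
  \<comment> \<open>The shift of w by v leaves v in g and h only, so that the exchanged inner
    integral is \<open>nn_conv g h\<close>.\<close>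
  also have "\<dots> = (\<integral>\<^sup>+v. (\<integral>\<^sup>+w. f (u - w) * g (w - v) * h v \<partial>lborel) \<partial>lborel)"
  proof (rule nn_integral_cong)
    fix v :: real
    show "(\<integral>\<^sup>+w. f (u - v - w) * g w * h v \<partial>lborel) = (\<integral>\<^sup>+w. f (u - w) * g (w - v) * h v \<partial>lborel)"
      by (subst nn_integral_shift [where u = v, symmetric]) simp_all
  qed
  also have "\<dots> = (\<integral>\<^sup>+w. (\<integral>\<^sup>+v. f (u - w) * g (w - v) * h v \<partial>lborel) \<partial>lborel)"
    by (rule lborel_pair.Fubini') simp
  also have "\<dots> = nn_conv f (nn_conv g h) u"
    unfolding nn_conv_def by (simp add: nn_integral_cmult mult.assoc)
  finally show "nn_conv (nn_conv f g) h u = nn_conv f (nn_conv g h) u" .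
qed

lemma nn_integral_nn_conv:
  assumes [measurable]: "f \<in> borel_measurable borel" "g \<in> borel_measurable borel"
  shows "(\<integral>\<^sup>+u. nn_conv f g u \<partial>lborel) = (\<integral>\<^sup>+u. f u \<partial>lborel) * (\<integral>\<^sup>+u. g u \<partial>lborel)"
proof -
  have "(\<integral>\<^sup>+u. nn_conv f g u \<partial>lborel) = (\<integral>\<^sup>+v. (\<integral>\<^sup>+u. f (u - v) * g v \<partial>lborel) \<partial>lborel)"
    unfolding nn_conv_def by (rule lborel_pair.Fubini') simp
  also have "\<dots> = (\<integral>\<^sup>+v. (\<integral>\<^sup>+u. f u \<partial>lborel) * g v \<partial>lborel)"
    by (simp add: nn_integral_multc nn_integral_shift)
  also have "\<dots> = (\<integral>\<^sup>+u. f u \<partial>lborel) * (\<integral>\<^sup>+u. g u \<partial>lborel)"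
    by (rule nn_integral_cmult) simp
  finally show ?thesis .
qed

text \<open>The exponential is multiplicative: exp (a u) = exp (a (u - v)) exp (a v), so the factor
  distributes over the two arguments of a convolution.\<close>

lemma nn_conv_tilt:
  assumes [measurable]: "f \<in> borel_measurable borel" "g \<in> borel_measurable borel"
  shows "nn_conv (\<lambda>u. ennreal (exp (a * u)) * f u) (\<lambda>u. ennreal (exp (a * u)) * g u) =
    (\<lambda>u. ennreal (exp (a * u)) * nn_conv f g u)"
proof
  fix u
  have "exp (a * (u - v)) * exp (a * v) = exp (a * u)" for v
    by (simp add: exp_add [symmetric] algebra_simps)
  then have "ennreal (exp (a * (u - v))) * f (u - v) * (ennreal (exp (a * v)) * g v) =
      ennreal (exp (a * u)) * (f (u - v) * g v)" for v
    by (metis (no_types, lifting) ennreal_mult exp_ge_zero mult.assoc mult.left_commute)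
  then show "nn_conv (\<lambda>u. ennreal (exp (a * u)) * f u) (\<lambda>u. ennreal (exp (a * u)) * g u) u =
      ennreal (exp (a * u)) * nn_conv f g u"
    unfolding nn_conv_def by (simp add: nn_integral_cmult)
qed

section \<open>Convolutions of the functions exp (a u - exp u) and their integral equation\<close>

text \<open>For a > 0 this is, up to the factor \<open>Gamma a\<close>, the density of the logarithm
  of a Gamma variable, not the logarithm of the Gamma function. For a = 0 it is the Laplace kernel
  exp (- exp u), which is bounded but not integrable.\<close>

definition log_gamma :: "real \<Rightarrow> real \<Rightarrow> real"
  where "log_gamma a u = exp (a * u - exp u)"

lemma log_gamma_nonneg [simp]: "0 \<le> log_gamma a u"
  by (simp add: log_gamma_def)

lemma borel_measurable_log_gamma [measurable]: "log_gamma a \<in> borel_measurable borel"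
  unfolding log_gamma_def by measurable

text \<open>The left fold mirrors \<open>recip_gamma_conv\<close>. The starting function is an
  arbitrary argument because it is itself replaced by convolutions below.\<close>

definition log_gamma_conv :: "(real \<Rightarrow> ennreal) \<Rightarrow> real list \<Rightarrow> real \<Rightarrow> ennreal"
  where "log_gamma_conv = foldl (\<lambda>f a. nn_conv f (\<lambda>u. ennreal (log_gamma a u)))"

lemma log_gamma_conv_simps [simp]:
  "log_gamma_conv f [] = f"
  "log_gamma_conv f (a # as) = log_gamma_conv (nn_conv f (\<lambda>u. ennreal (log_gamma a u))) as"
  "log_gamma_conv f (as @ [a]) = nn_conv (log_gamma_conv f as) (\<lambda>u. ennreal (log_gamma a u))"
  by (simp_all add: log_gamma_conv_def)

lemma borel_measurable_log_gamma_conv [measurable]: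
  assumes "f \<in> borel_measurable borel"
  shows "log_gamma_conv f as \<in> borel_measurable borel"
  using assms by (induction as arbitrary: f) auto

text \<open>Associativity brings a left factor of the starting function out of the whole fold, where
  it can be commuted past the other factors.\<close>

lemma log_gamma_conv_nn_conv:
  assumes [measurable]: "f \<in> borel_measurable borel" "g \<in> borel_measurable borel"
  shows "log_gamma_conv (nn_conv f g) as = nn_conv f (log_gamma_conv g as)"
  by (induction as rule: rev_induct) (simp_all add: nn_conv_assoc)

lemma log_gamma_tilt: "ennreal (exp (b * u)) * ennreal (log_gamma a u) = ennreal (log_gamma (a + b) u)"
  by (simp add: log_gamma_def ennreal_mult [symmetric] exp_add [symmetric] algebra_simps)

lemma log_gamma_conv_tilt:
  "(\<lambda>u. ennreal (exp (b * u)) * log_gamma_conv (\<lambda>u. ennreal (log_gamma a u)) as u) =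
    log_gamma_conv (\<lambda>u. ennreal (log_gamma (a + b) u)) (map (\<lambda>a. a + b) as)"
proof (induction as rule: rev_induct)
  case (snoc a' as)
  then show ?case by (simp add: nn_conv_tilt [symmetric] log_gamma_tilt)
qed (simp add: log_gamma_tilt)

lemma log_gamma_0_eq:
  "(\<lambda>u. ennreal (log_gamma 0 u)) = nn_conv (indicator {..0}) (\<lambda>u. ennreal (log_gamma 1 u))"
proof
  fix u :: real
  have "((\<lambda>v::real. - exp (- exp v)) \<longlongrightarrow> - 0) at_top"
    by (intro tendsto_minus filterlim_compose[OF exp_at_bot]
      filterlim_compose[OF filterlim_uminus_at_bot_at_top] exp_at_top)
  then have "((\<lambda>v::real. - exp (- exp v)) \<longlongrightarrow> 0) at_top" by simp
  then have "(\<integral>\<^sup>+v. ennreal (log_gamma 1 v) * indicator {u..} v \<partial>lborel) = 0 - - exp (- exp u)"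
    by (intro nn_integral_FTC_atLeast)
      (auto simp: log_gamma_def exp_diff exp_minus field_simps intro!: derivative_eq_intros)
  moreover have "indicator {..0} (u - v) = (indicator {u..} v :: ennreal)" for v
    by (auto simp: indicator_def)
  ultimately show "ennreal (log_gamma 0 u) = nn_conv (indicator {..0}) (\<lambda>u. ennreal (log_gamma 1 u)) u"
    by (simp add: nn_conv_def log_gamma_def mult.commute)
qed

text \<open>Tilting by \<open>\<nu>\<close> permutes the exponents \<open>0, \<nu>, \<dots>, n \<nu>\<close> cyclically, up to the replacement of
  \<open>0\<close> by \<open>1\<close>.\<close>
lemma log_gamma_conv_integral_equation:
  assumes n: "n \<ge> 1" and \<nu>: "\<nu> = 1 / (real n + 1)"
    and F_def: "F = log_gamma_conv (\<lambda>u. ennreal (log_gamma 0 u)) (map (\<lambda>j. real j * \<nu>) [1..<n + 1])"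
  shows "F = nn_conv (indicator {..0}) (\<lambda>u. ennreal (exp (\<nu> * u)) * F u)"
proof -
  let ?g = "\<lambda>a u. ennreal (log_gamma a u)"
  define as where "as = map (\<lambda>j. real j * \<nu>) [2..<n + 1]"
  have as: "map (\<lambda>j. real j * \<nu>) [1..<n + 1] = \<nu> # as"
    using n by (simp add: as_def upt_rec numeral_2_eq_2)
  have "map (\<lambda>a. a + \<nu>) (map (\<lambda>j. real j * \<nu>) [1..<n + 1]) = map (\<lambda>j. real j * \<nu>) (map Suc [1..<n + 1])"
    by (simp add: algebra_simps)
  also have "map Suc [1..<n + 1] = [2..<n + 1] @ [n + 1]"
    using n by (simp only: map_Suc_upt) (simp add: numeral_2_eq_2)
  \<comment> \<open>The last exponent (n + 1) \<nu> equals 1 by the choice of \<nu>.\<close>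
  also have "map (\<lambda>j. real j * \<nu>) \<dots> = as @ [1]"
    using \<nu> by (simp add: as_def field_simps)
  finally have shift: "map (\<lambda>a. a + \<nu>) (map (\<lambda>j. real j * \<nu>) [1..<n + 1]) = as @ [1]" .
  have "F = log_gamma_conv (nn_conv (indicator {..0}) (?g 1)) (\<nu> # as)"
    unfolding F_def as log_gamma_0_eq ..
  also have "\<dots> = nn_conv (indicator {..0}) (log_gamma_conv (?g 1) (\<nu> # as))"
    by (rule log_gamma_conv_nn_conv) simp_all
  also have "log_gamma_conv (?g 1) (\<nu> # as) = nn_conv (?g 1) (log_gamma_conv (?g \<nu>) as)"
    by (simp add: log_gamma_conv_nn_conv)
  \<comment> \<open>Commutativity moves the factor with exponent 1 from the front to the end, which
    gives the list of shifted exponents.\<close>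
  also have "\<dots> = log_gamma_conv (?g \<nu>) (as @ [1])"
    by (simp add: nn_conv_commute)
  also have "\<dots> = (\<lambda>u. ennreal (exp (\<nu> * u)) * F u)"
    unfolding F_def log_gamma_conv_tilt shift by simp
  finally show ?thesis .
qed


section \<open>Gamma integrals, continuity and boundedness\<close>

text \<open>The substitution s = exp w maps [-n, n] onto [exp (-n), exp n]; monotone convergence in
  n extends it from these compact intervals to the half-line.\<close>

lemma nn_integral_exp_substitution:
  fixes f :: "real \<Rightarrow> real"
  assumes [measurable]: "f \<in> borel_measurable borel" and f: "\<And>s. 0 \<le> f s"
  shows "(\<integral>\<^sup>+s. ennreal (indicator {0<..} s * f s) \<partial>lborel) =
    (\<integral>\<^sup>+w. ennreal (f (exp w) * exp w) \<partial>lborel)"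
proof -
  let ?l = "\<lambda>n s. ennreal (f s * indicator {exp (- real n)..exp (real n)} s)"
  let ?r = "\<lambda>n w. ennreal (f (exp w) * exp w * indicator {- real n..real n} w)"
  have "(\<lambda>n. \<integral>\<^sup>+s. ?l n s \<partial>lborel) \<longlonglongrightarrow> (\<integral>\<^sup>+s. ennreal (indicator {0<..} s * f s) \<partial>lborel)"
  proof (rule nn_integral_LIMSEQ)
    show "incseq ?l"
    proof (intro incseq_SucI le_funI ennreal_leI mult_left_mono f)
      fix n and s :: real
      have "exp (- real (Suc n)) \<le> exp (- real n)" "exp (real n) \<le> exp (real (Suc n))"
        by simp_all
      then show "indicator {exp (- real n)..exp (real n)} s \<le>
          (indicator {exp (- real (Suc n))..exp (real (Suc n))} s :: real)"
        by (auto simp del: exp_le_cancel_iff split: split_indicator)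
    qed
    show "(\<lambda>n. ?l n s) \<longlonglongrightarrow> ennreal (indicator {0<..} s * f s)" for s
    proof (cases "0 < s")
      case True
      obtain N where N: "\<bar>ln s\<bar> \<le> real N" using real_arch_simple by blast
      have "?l n s = ennreal (indicator {0<..} s * f s)" if "n \<ge> N" for n
      proof -
        have "- real n \<le> ln s" "ln s \<le> real n" using N that by auto
        then have "exp (- real n) \<le> exp (ln s)" "exp (ln s) \<le> exp (real n)"
          by simp_all
        then show ?thesis using True by simp
      qed
      then show ?thesis
        by (intro tendsto_eventually eventually_sequentiallyI)
    next
      case False
      then have "\<not> exp (- real n) \<le> s" for n
        using exp_gt_zero [of "- real n"] by linarith
      then show ?thesis using False by simp
    qed
  qed simp
  moreover have "(\<lambda>n. \<integral>\<^sup>+w. ?r n w \<partial>lborel) \<longlonglongrightarrow> (\<integral>\<^sup>+w. ennreal (f (exp w) * exp w) \<partial>lborel)"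
  proof (rule nn_integral_LIMSEQ)
    show "incseq ?r"
      by (auto simp: incseq_def le_fun_def intro!: ennreal_leI mult_nonneg_nonneg f split: split_indicator)
    show "(\<lambda>n. ?r n w) \<longlonglongrightarrow> ennreal (f (exp w) * exp w)" for w
    proof -
      obtain N where N: "\<bar>w\<bar> \<le> real N" using real_arch_simple by blast
      have "?r n w = ennreal (f (exp w) * exp w)" if "n \<ge> N" for n
        using N that by (auto split: split_indicator)
      then show ?thesis
        by (intro tendsto_eventually eventually_sequentiallyI)
    qed
  qed simp
  moreover have "(\<integral>\<^sup>+s. ?l n s \<partial>lborel) = (\<integral>\<^sup>+w. ?r n w \<partial>lborel)" for n
    by (rule nn_integral_substitution)
      (auto intro!: derivative_eq_intros continuous_intros simp: set_borel_measurable_def)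
  ultimately show ?thesis
    by (simp add: LIMSEQ_unique)
qed

lemma nn_integral_log_gamma:
  assumes "0 < a"
  shows "(\<integral>\<^sup>+u. ennreal (log_gamma a u) \<partial>lborel) = ennreal (Gamma a)"
proof -
  let ?f = "\<lambda>t::real. t powr (a - 1) / exp t"
  have "(\<integral>\<^sup>+u. ennreal (log_gamma a u) \<partial>lborel) = (\<integral>\<^sup>+u. ennreal (?f (exp u) * exp u) \<partial>lborel)"
    by (intro nn_integral_cong arg_cong [where f = ennreal])
      (simp add: log_gamma_def powr_def exp_diff [symmetric] exp_add [symmetric] algebra_simps)
  also have "\<dots> = (\<integral>\<^sup>+s. ennreal (indicator {0<..} s * ?f s) \<partial>lborel)"
    by (rule nn_integral_exp_substitution [symmetric]) simp_all
  \<comment> \<open>The two integrands agree at s = 0 as well, since \<open>0 powr y = 0\<close> for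
    every y.\<close>
  also have "\<dots> = (\<integral>\<^sup>+s. ennreal (indicator {0..} s * ?f s) \<partial>lborel)"
    by (intro nn_integral_cong) (auto split: split_indicator)
  also have "\<dots> = ennreal (Gamma a)"
    by (rule nn_integral_has_integral_lebesgue [OF _ Gamma_integral_real [OF assms]]) simp
  finally show ?thesis .
qed

lemma nn_integral_log_gamma_conv:
  assumes "0 < a" "\<forall>b\<in>set bs. 0 < b"
  shows "(\<integral>\<^sup>+u. log_gamma_conv (\<lambda>u. ennreal (log_gamma a u)) bs u \<partial>lborel) =
    ennreal (Gamma a * prod_list (map Gamma bs))"
  using assms(2)
proof (induction bs rule: rev_induct)
  case Nil
  then show ?case by (simp add: nn_integral_log_gamma assms)
next
  case (snoc b bs)
  then have "0 \<le> prod_list (map Gamma bs)"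
    by (intro prod_list_nonneg) (auto intro: Gamma_real_nonneg less_imp_le)
  with snoc assms show ?case
    by (simp add: nn_integral_nn_conv nn_integral_log_gamma ennreal_mult [symmetric] Gamma_real_nonneg mult.assoc)
qed

lemma integrable_log_gamma:
  assumes "0 < a"
  shows "integrable lborel (log_gamma a)"
  using nn_integral_log_gamma [OF assms] by (intro integrableI_nonneg) auto

text \<open>For u \<ge> 0 this combines exp u \<ge> u^2 / 2 with 2 a u \<le> a^2 + u^2; for u < 0
  the exponent is negative. The bound includes a = 0, where integrability fails.\<close>

lemma log_gamma_le:
  assumes "0 \<le> a"
  shows "log_gamma a u \<le> exp (a\<^sup>2 / 2)"
proof -
  have "a * u - exp u \<le> a\<^sup>2 / 2"
  proof (cases "0 \<le> u")
    case True
    then have "u\<^sup>2 / 2 \<le> exp u"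
      using exp_lower_Taylor_quadratic [of u] by simp
    moreover have "a * u \<le> a\<^sup>2 / 2 + u\<^sup>2 / 2"
      using sum_squares_bound [of a u] by simp
    ultimately show ?thesis by simp
  next
    case False
    then have "a * u \<le> 0" using assms by (simp add: mult_nonneg_nonpos)
    moreover have "0 \<le> exp u" "0 \<le> a\<^sup>2 / 2" by simp_all
    ultimately show ?thesis by linarith
  qed
  then show ?thesis by (simp add: log_gamma_def)
qed

lemma continuous_on_convolution:
  fixes k g :: "real \<Rightarrow> real"
  assumes k: "continuous_on UNIV k" "\<And>u. \<bar>k u\<bar> \<le> B" and g: "integrable lborel g"
  shows "continuous_on UNIV (\<lambda>u. \<integral>v. k (u - v) * g v \<partial>lborel)"
proof -
  have [measurable]: "k \<in> borel_measurable borel" "g \<in> borel_measurable borel"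
    using k(1) g by (auto intro: borel_measurable_continuous_onI)
  have "(\<lambda>n. \<integral>v. k (x n - v) * g v \<partial>lborel) \<longlonglongrightarrow> (\<integral>v. k (u - v) * g v \<partial>lborel)"
    if "x \<longlonglongrightarrow> u" for x u
  proof (rule integral_dominated_convergence [where w = "\<lambda>v. B * \<bar>g v\<bar>"])
    have "(\<lambda>n. k (x n - v)) \<longlonglongrightarrow> k (u - v)" for v
      by (rule continuous_on_tendsto_compose [OF k(1)]) (auto intro!: tendsto_intros that)
    then show "AE v in lborel. (\<lambda>n. k (x n - v) * g v) \<longlonglongrightarrow> k (u - v) * g v"
      by (auto intro!: tendsto_intros)
    show "AE v in lborel. norm (k (x n - v) * g v) \<le> B * \<bar>g v\<bar>" for n
      by (simp add: abs_mult mult_right_mono k(2))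
  qed (use g in simp_all)
  then show ?thesis
    by (auto simp: continuous_on_sequentially comp_def)
qed

text \<open>Provides a real-valued version of the convolution that can be differentiated. Convolving
  a bounded continuous function with an integrable one preserves both properties; the first factor
  enters only through them, which admits a = 0.\<close>

lemma log_gamma_conv_continuous_bounded:
  assumes a: "0 \<le> a" and bs: "\<forall>b\<in>set bs. 0 < b"
  obtains k B where "continuous_on UNIV k" "\<And>u. 0 \<le> k u" "\<And>u. k u \<le> B"
    "log_gamma_conv (\<lambda>u. ennreal (log_gamma a u)) bs = (\<lambda>u. ennreal (k u))"
proof -
  have "\<exists>k B. continuous_on UNIV k \<and> (\<forall>u. 0 \<le> k u) \<and> (\<forall>u. k u \<le> B) \<and>
    log_gamma_conv (\<lambda>u. ennreal (log_gamma a u)) bs = (\<lambda>u. ennreal (k u))"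
    using bs
  proof (induction bs rule: rev_induct)
    case Nil
    have "continuous_on UNIV (log_gamma a)"
      unfolding log_gamma_def by (intro continuous_intros)
    then show ?case
      using log_gamma_le [OF a] by (intro exI [of _ "log_gamma a"] exI [of _ "exp (a\<^sup>2 / 2)"]) simp
  next
    case (snoc b bs)
    then obtain k B where k: "continuous_on UNIV k" "\<And>u. 0 \<le> k u" "\<And>u. k u \<le> B"
      and eq: "log_gamma_conv (\<lambda>u. ennreal (log_gamma a u)) bs = (\<lambda>u. ennreal (k u))"
      by auto
    have [measurable]: "k \<in> borel_measurable borel"
      using k(1) by (rule borel_measurable_continuous_onI)
    have int: "integrable lborel (log_gamma b)"
      using snoc.prems by (intro integrable_log_gamma) simp
    define k' where "k' u = (\<integral>v. k (u - v) * log_gamma b v \<partial>lborel)" for u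
    have int': "integrable lborel (\<lambda>v. k (u - v) * log_gamma b v)" for u
      by (rule Bochner_Integration.integrable_bound [OF integrable_mult_right [OF int, of B]])
        (auto simp: abs_mult k intro!: mult_right_mono order_trans [OF k(3)])
    have "continuous_on UNIV k'"
      unfolding k'_def using k int by (intro continuous_on_convolution) auto
    moreover have "0 \<le> k' u" for u
      unfolding k'_def using k(2) by simp
    moreover have "k' u \<le> (\<integral>v. B * log_gamma b v \<partial>lborel)" for u
      unfolding k'_def using k int int' by (intro integral_mono) (auto intro: mult_right_mono)
    moreover have "log_gamma_conv (\<lambda>u. ennreal (log_gamma a u)) (bs @ [b]) u = ennreal (k' u)" for u
      unfolding log_gamma_conv_simps eq nn_conv_def k'_def using k int'
      by (simp add: ennreal_mult [symmetric] nn_integral_eq_integral)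
    ultimately show ?case by blast
  qed
  then show ?thesis using that by blast
qed

section \<open>From the integral equation to the closed form\<close>

text \<open>Since k is real-valued, the tails are finite and can be subtracted: near u, k is a
  constant minus the integral of g from u - 1, and the fundamental theorem of calculus
  applies.\<close>

lemma tail_integral_has_derivative:
  fixes k g :: "real \<Rightarrow> real"
  assumes g: "continuous_on UNIV g" "\<And>u. 0 \<le> g u" and k: "\<And>u. 0 \<le> k u"
    and tail: "\<And>u. ennreal (k u) = (\<integral>\<^sup>+v. ennreal (g v) * indicator {u..} v \<partial>lborel)"
  shows "(k has_real_derivative - g u) (at u)"
proof -
  have [measurable]: "g \<in> borel_measurable borel"
    using g(1) by (rule borel_measurable_continuous_onI)
  have eq: "k (u - 1) - integral {u - 1..x} g = k x" if "u - 1 \<le> x" for x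
  proof -
    have int: "g integrable_on {u - 1..x}"
      by (intro integrable_continuous_real continuous_on_subset [OF g(1)]) auto
    have "ennreal (k (u - 1)) =
        (\<integral>\<^sup>+v. ennreal (indicator {u - 1..x} v * g v) + ennreal (g v) * indicator {x..} v \<partial>lborel)"
      unfolding tail
    proof (rule nn_integral_cong_AE)
      show "AE v in lborel. ennreal (g v) * indicator {u - 1..} v =
          ennreal (indicator {u - 1..x} v * g v) + ennreal (g v) * indicator {x..} v"
        \<comment> \<open>The intervals [u - 1, x] and [x, \<infinity>) overlap in the null set
          {x}.\<close>
        using AE_lborel_singleton [of x] by eventually_elim (use that in \<open>auto split: split_indicator\<close>)
    qed
    also have "\<dots> = (\<integral>\<^sup>+v. ennreal (indicator {u - 1..x} v * g v) \<partial>lborel) + ennreal (k x)"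
      unfolding tail by (rule nn_integral_add) simp_all
    also have "(\<integral>\<^sup>+v. ennreal (indicator {u - 1..x} v * g v) \<partial>lborel) = ennreal (integral {u - 1..x} g)"
      by (rule nn_integral_has_integral_lebesgue) (use g int in \<open>auto intro: integrable_integral\<close>)
    also have "ennreal (integral {u - 1..x} g) + ennreal (k x) = ennreal (integral {u - 1..x} g + k x)"
      using k g by (intro ennreal_plus [symmetric] Henstock_Kurzweil_Integration.integral_nonneg int) auto
    finally show ?thesis
      using k g by (subst (asm) ennreal_inj)
        (auto intro!: add_nonneg_nonneg Henstock_Kurzweil_Integration.integral_nonneg int)
  qed
  have "((\<lambda>x. k (u - 1) - integral {u - 1..x} g) has_real_derivative - g u) (at u within {u - 1..u + 1})"
    by (auto intro!: derivative_eq_intros integral_has_real_derivative continuous_on_subset [OF g(1)])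
  then have "((\<lambda>x. k (u - 1) - integral {u - 1..x} g) has_real_derivative - g u) (at u)"
    by (simp add: at_within_Icc_at)
  then show ?thesis
    by (rule has_field_derivative_transform_within_open [where S = "{u - 1<..}"])
      (use eq in \<open>auto simp: less_imp_le\<close>)
qed

text \<open>The integral equation becomes k' u = - exp (\<nu> u) k u, which determines k up to a
  constant. The constant is read off at minus infinity, where the factor G with exponent 0 tends to
  1 and leaves the total mass of the other factors.\<close>

lemma log_gamma_conv_closed_form:
  assumes n: "n \<ge> 1" and \<nu>: "\<nu> = 1 / (real n + 1)" and ms: "ms = map (\<lambda>j. real j * \<nu>) [1..<n + 1]"
  shows "log_gamma_conv (\<lambda>u. ennreal (log_gamma 0 u)) ms u =
    ennreal (prod_list (map Gamma ms) * exp (- exp (\<nu> * u) / \<nu>))"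
proof -
  have "0 < \<nu>" using \<nu> by simp
  then have pos: "\<forall>m\<in>set ms. 0 < m" using ms by auto
  obtain m ms' where Cons: "ms = m # ms'" using n ms by (simp add: upt_rec)
  define P where "P = prod_list (map Gamma ms)"
  define K where "K = log_gamma_conv (\<lambda>u. ennreal (log_gamma m u)) ms'"
  have [measurable]: "K \<in> borel_measurable borel" unfolding K_def by measurable
  have K: "(\<integral>\<^sup>+u. K u \<partial>lborel) = ennreal P"
    unfolding K_def P_def Cons using pos Cons by (simp add: nn_integral_log_gamma_conv)
  have "0 < P" unfolding P_def using pos by (induction ms) (auto intro: Gamma_real_pos)
  obtain k B where k: "continuous_on UNIV k" "\<And>u. 0 \<le> k u"
    and F: "log_gamma_conv (\<lambda>u. ennreal (log_gamma 0 u)) ms = (\<lambda>u. ennreal (k u))"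
    by (rule log_gamma_conv_continuous_bounded [of 0 ms]) (use pos in auto)
  have F': "(\<lambda>u. ennreal (k u)) = nn_conv (\<lambda>u. ennreal (log_gamma 0 u)) K"
    unfolding F [symmetric] K_def Cons by (simp add: log_gamma_conv_nn_conv)
  have eq: "ennreal (k u) = (\<integral>\<^sup>+v. ennreal (exp (\<nu> * v) * k v) * indicator {u..} v \<partial>lborel)" for u
  proof -
    have "ennreal (k u) = nn_conv (indicator {..0}) (\<lambda>u. ennreal (exp (\<nu> * u)) * ennreal (k u)) u"
      using log_gamma_conv_integral_equation [OF n \<nu> F [symmetric, unfolded ms]] by (rule fun_cong)
    also have "\<dots> = (\<integral>\<^sup>+v. ennreal (exp (\<nu> * v) * k v) * indicator {u..} v \<partial>lborel)"
      unfolding nn_conv_def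
      by (intro nn_integral_cong) (auto simp: k ennreal_mult split: split_indicator)
    finally show ?thesis .
  qed
  have deriv: "(k has_real_derivative - (exp (\<nu> * u) * k u)) (at u)" for u
    by (rule tail_integral_has_derivative [OF _ _ k(2) eq]) (use k in \<open>auto intro!: continuous_intros\<close>)
  \<comment> \<open>The integrating factor of the differential equation.\<close>
  have "((\<lambda>u. k u * exp (exp (\<nu> * u) / \<nu>)) has_real_derivative 0) (at u)" for u
    using \<open>0 < \<nu>\<close> by (auto intro!: derivative_eq_intros deriv)
  then obtain C where C: "k u * exp (exp (\<nu> * u) / \<nu>) = C" for u
    using DERIV_isconst_all by blast
  have k_eq: "k u = C * exp (- exp (\<nu> * u) / \<nu>)" for u
    using C [of u] by (simp add: exp_minus field_simps)
  have bot: "filterlim (\<lambda>i. - real i) at_bot sequentially"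
    by (intro filterlim_compose [OF filterlim_uminus_at_bot_at_top] filterlim_real_sequentially)
  have "(\<lambda>i. k (- real i)) \<longlonglongrightarrow> C * exp (- 0 / \<nu>)"
    unfolding k_eq using \<open>0 < \<nu>\<close>
    by (intro tendsto_intros filterlim_compose [OF exp_at_bot]
        filterlim_tendsto_pos_mult_at_bot [OF tendsto_const _ bot]) auto
  then have "(\<lambda>i. ennreal (k (- real i))) \<longlonglongrightarrow> ennreal C"
    by (intro tendsto_ennrealI) simp
  moreover have "(\<lambda>i. ennreal (k (- real i))) \<longlonglongrightarrow> ennreal P"
  proof -
    \<comment> \<open>As i grows, exp (- exp (- i - v)) increases to 1, so monotone convergence
      yields the mass P of K.\<close>
    have "(\<lambda>i. \<integral>\<^sup>+v. ennreal (log_gamma 0 (- real i - v)) * K v \<partial>lborel) \<longlonglongrightarrow> (\<integral>\<^sup>+v. ennreal 1 * K v \<partial>lborel)"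
    proof (rule nn_integral_LIMSEQ)
      show "incseq (\<lambda>i v. ennreal (log_gamma 0 (- real i - v)) * K v)"
        by (auto simp: incseq_def le_fun_def log_gamma_def intro!: mult_right_mono ennreal_leI)
      fix v
      have "(\<lambda>i. exp (0 - exp (- v) * exp (- real i))) \<longlonglongrightarrow> exp (0 - exp (- v) * 0)"
        by (intro tendsto_intros filterlim_compose [OF exp_at_bot bot])
      moreover have "log_gamma 0 (- real i - v) = exp (0 - exp (- v) * exp (- real i))" for i
        by (simp add: log_gamma_def exp_diff exp_minus field_simps)
      ultimately have "(\<lambda>i. ennreal (log_gamma 0 (- real i - v))) \<longlonglongrightarrow> ennreal 1"
        by (intro tendsto_ennrealI) simp
      then show "(\<lambda>i. ennreal (log_gamma 0 (- real i - v)) * K v) \<longlonglongrightarrow> ennreal 1 * K v"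
        by (intro tendsto_mult_ennreal) auto
    qed simp
    then show ?thesis
      using K fun_cong [OF F'] by (simp add: nn_conv_def)
  qed
  ultimately have "ennreal C = ennreal P"
    by (rule LIMSEQ_unique)
  \<comment> \<open>\<open>ennreal\<close> sends all negative reals to 0; positivity of P excludes
    this case for C.\<close>
  with \<open>0 < P\<close> have "C = P"
    by (metis ennreal_eq_0_iff ennreal_inj less_eq_real_def linorder_not_le)
  then show ?thesis by (simp add: F k_eq P_def)
qed


section \<open>Mellin convolution in logarithmic coordinates\<close>

lemma recip_gamma_density_eq:
  assumes "0 < x" "0 < t"
  shows "recip_gamma_density m x t = log_gamma m (ln t - ln x) / (x * Gamma m)"
proof -
  have "exp (ln t - ln x) = t / x"
    using assms by (simp add: exp_diff)
  moreover have "exp (m * (ln t - ln x)) = t powr m / x powr m"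
    using assms by (simp add: powr_def right_diff_distrib exp_diff)
  ultimately have "log_gamma m (ln t - ln x) = t powr m / x powr m * exp (- t / x)"
    by (simp add: log_gamma_def exp_diff exp_minus divide_inverse)
  then show ?thesis
    using assms by (simp add: recip_gamma_density_def powr_add mult_ac)
qed

lemma prod_list_Gamma_pos:
  assumes "\<forall>m\<in>set ms. 0 < (m::real)"
  shows "0 < prod_list (map Gamma ms)"
  using assms by (induction ms) (auto intro: Gamma_real_pos)

text \<open>With s = exp w the factor 1/s of the second density absorbs the Jacobian, and the
  arguments w - ln x and ln t - w add up to ln t - ln x. The form with \<open>enn2real\<close> holds
  even where the integral is infinite, since both sides are then 0.\<close>

lemma mellin_conv_log_gamma:
  fixes k :: "real \<Rightarrow> real"
  assumes k: "continuous_on UNIV k" "\<And>u. 0 \<le> k u" and "0 < c" "0 < m" "0 < x" "0 < t"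
    and f: "\<And>s. 0 < s \<Longrightarrow> f x s = k (ln s - ln x) / (x * c)"
  shows "mellin_conv f (recip_gamma_density m) x t =
    enn2real (nn_conv (\<lambda>u. ennreal (k u)) (\<lambda>u. ennreal (log_gamma m u)) (ln t - ln x)) /
      (x * (c * Gamma m))"
proof -
  have [measurable]: "k \<in> borel_measurable borel"
    using k(1) by (rule borel_measurable_continuous_onI)
  have Gm: "0 < Gamma m" using \<open>0 < m\<close> by (rule Gamma_real_pos)
  define D where "D = x * (c * Gamma m)"
  have "0 < D" using \<open>0 < x\<close> \<open>0 < c\<close> Gm by (simp add: D_def)
  let ?h = "\<lambda>s. k (ln s - ln x) * log_gamma m (ln t - ln s) / D"
  \<comment> \<open>Writing \<bar>s\<bar> for s makes the integrand nonnegative on the whole line,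
    as \<open>nn_integral_exp_substitution\<close> demands.\<close>
  have "mellin_conv f (recip_gamma_density m) x t = (\<integral>s. indicator {0<..} s * (?h s / \<bar>s\<bar>) \<partial>lborel)"
    unfolding mellin_conv_def set_lebesgue_integral_def using \<open>0 < t\<close>
    by (intro Bochner_Integration.integral_cong)
      (auto simp: f recip_gamma_density_eq D_def split: split_indicator)
  also have "\<dots> = enn2real (\<integral>\<^sup>+s. ennreal (indicator {0<..} s * (?h s / \<bar>s\<bar>)) \<partial>lborel)"
    using k(2) \<open>0 < D\<close> by (intro integral_eq_nn_integral) auto
  also have "(\<integral>\<^sup>+s. ennreal (indicator {0<..} s * (?h s / \<bar>s\<bar>)) \<partial>lborel) =
      (\<integral>\<^sup>+w. ennreal (?h (exp w) / \<bar>exp w\<bar> * exp w) \<partial>lborel)"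
    using k(2) \<open>0 < D\<close> by (intro nn_integral_exp_substitution) auto
  also have "\<dots> = (\<integral>\<^sup>+w. ennreal (1 / D) *
      (ennreal (k (w - ln x)) * ennreal (log_gamma m (ln t - w))) \<partial>lborel)"
    using k(2) \<open>0 < D\<close> by (intro nn_integral_cong) (simp add: ennreal_mult [symmetric])
  also have "\<dots> = ennreal (1 / D) *
      (\<integral>\<^sup>+w. ennreal (k (w - ln x)) * ennreal (log_gamma m (ln t - w)) \<partial>lborel)"
    by (rule nn_integral_cmult) simp
  also have "(\<integral>\<^sup>+w. ennreal (k (w - ln x)) * ennreal (log_gamma m (ln t - w)) \<partial>lborel) =
      nn_conv (\<lambda>u. ennreal (k u)) (\<lambda>u. ennreal (log_gamma m u)) (ln t - ln x)"
    unfolding nn_conv_def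
    by (subst nn_integral_reflect [where u = "ln t", symmetric]) (simp_all add: algebra_simps)
  finally show ?thesis
    using \<open>0 < D\<close> by (simp add: D_def enn2real_mult)
qed

text \<open>Induction from the right follows the left-associated definition: each new parameter is
  one application of \<open>mellin_conv_log_gamma\<close>, and finiteness of the additive
  convolution removes \<open>enn2real\<close>.\<close>

lemma recip_gamma_conv_log_form:
  assumes "ms \<noteq> []" "\<forall>m\<in>set ms. 0 < m"
  obtains k where "continuous_on UNIV k" "\<And>u. 0 \<le> k u"
    "log_gamma_conv (\<lambda>u. ennreal (log_gamma (hd ms) u)) (tl ms) = (\<lambda>u. ennreal (k u))"
    "\<And>x t. 0 < x \<Longrightarrow> 0 < t \<Longrightarrow>
      recip_gamma_conv ms x t = k (ln t - ln x) / (x * prod_list (map Gamma ms))"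
proof -
  obtain m ms' where ms: "ms = m # ms'" using assms(1) by (cases ms) auto
  have m: "0 < m" using assms ms by simp
  have "\<forall>m\<in>set ms'. 0 < m" using assms ms by simp
  then have formula: "foldl mellin_conv (recip_gamma_density m) (map recip_gamma_density ms') x t =
    enn2real (log_gamma_conv (\<lambda>u. ennreal (log_gamma m u)) ms' (ln t - ln x)) /
      (x * (Gamma m * prod_list (map Gamma ms')))" if "0 < x" "0 < t" for x t
    using that
  proof (induction ms' arbitrary: t rule: rev_induct)
    case Nil
    then show ?case by (simp add: recip_gamma_density_eq)
  next
    case (snoc b bs)
    obtain k B where k: "continuous_on UNIV k" "\<And>u. 0 \<le> k u"
      and eq: "log_gamma_conv (\<lambda>u. ennreal (log_gamma m u)) bs = (\<lambda>u. ennreal (k u))"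
      by (rule log_gamma_conv_continuous_bounded [of m bs]) (use snoc.prems m in auto)
    have "0 < prod_list (map Gamma bs)"
      using snoc.prems by (intro prod_list_Gamma_pos) simp
    moreover have "foldl mellin_conv (recip_gamma_density m) (map recip_gamma_density bs) x s =
        k (ln s - ln x) / (x * (Gamma m * prod_list (map Gamma bs)))" if "0 < s" for s
      using snoc.IH [of s] snoc.prems that k(2) by (simp add: eq)
    ultimately have "mellin_conv (foldl mellin_conv (recip_gamma_density m) (map recip_gamma_density bs))
        (recip_gamma_density b) x t =
      enn2real (nn_conv (\<lambda>u. ennreal (k u)) (\<lambda>u. ennreal (log_gamma b u)) (ln t - ln x)) /
        (x * (Gamma m * prod_list (map Gamma bs) * Gamma b))"
      using snoc.prems k Gamma_real_pos [OF m] by (intro mellin_conv_log_gamma) simp_all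
    then show ?case
      by (simp add: eq mult.assoc)
  qed
  obtain k B where k: "continuous_on UNIV k" "\<And>u. 0 \<le> k u"
    and eq: "log_gamma_conv (\<lambda>u. ennreal (log_gamma m u)) ms' = (\<lambda>u. ennreal (k u))"
    by (rule log_gamma_conv_continuous_bounded [of m ms']) (use assms ms in auto)
  show ?thesis
    by (rule that [of k]) (use k formula in \<open>auto simp: ms eq recip_gamma_conv_def\<close>)
qed

text \<open>Serves twice: f = 1 gives the total mass, and f x = exp (- l x) gives the Laplace
  transform.\<close>

lemma nn_integral_recip_gamma_conv:
  fixes f :: "real \<Rightarrow> real"
  assumes ms: "ms \<noteq> []" "\<forall>m\<in>set ms. 0 < m" and "0 < c"
    and [measurable]: "f \<in> borel_measurable borel" and f: "\<And>x. 0 \<le> f x"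
  shows "(\<integral>\<^sup>+x. ennreal (indicator {0<..} x * (f x * recip_gamma_conv ms x c)) \<partial>lborel) =
    ennreal (1 / prod_list (map Gamma ms)) *
      (\<integral>\<^sup>+v. ennreal (f (exp (ln c - v))) *
        log_gamma_conv (\<lambda>u. ennreal (log_gamma (hd ms) u)) (tl ms) v \<partial>lborel)"
proof -
  obtain k where k: "continuous_on UNIV k" "\<And>u. 0 \<le> k u"
    and K: "log_gamma_conv (\<lambda>u. ennreal (log_gamma (hd ms) u)) (tl ms) = (\<lambda>u. ennreal (k u))"
    and eq: "\<And>x t. 0 < x \<Longrightarrow> 0 < t \<Longrightarrow>
      recip_gamma_conv ms x t = k (ln t - ln x) / (x * prod_list (map Gamma ms))"
    using recip_gamma_conv_log_form [OF ms] by blast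
  have [measurable]: "k \<in> borel_measurable borel"
    using k(1) by (rule borel_measurable_continuous_onI)
  define P where "P = prod_list (map Gamma ms)"
  have "0 < P" unfolding P_def using ms(2) by (rule prod_list_Gamma_pos)
  let ?h = "\<lambda>x. f x * k (ln c - ln x) / P"
  have "(\<integral>\<^sup>+x. ennreal (indicator {0<..} x * (f x * recip_gamma_conv ms x c)) \<partial>lborel) =
      (\<integral>\<^sup>+x. ennreal (indicator {0<..} x * (?h x / \<bar>x\<bar>)) \<partial>lborel)"
    using \<open>0 < c\<close> by (intro nn_integral_cong) (auto simp: eq P_def mult.commute split: split_indicator)
  also have "\<dots> = (\<integral>\<^sup>+w. ennreal (?h (exp w) / \<bar>exp w\<bar> * exp w) \<partial>lborel)"
    using k(2) f \<open>0 < P\<close> by (intro nn_integral_exp_substitution) auto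
  also have "\<dots> = (\<integral>\<^sup>+w. ennreal (1 / P) * (ennreal (f (exp w)) * ennreal (k (ln c - w))) \<partial>lborel)"
    using k(2) f \<open>0 < P\<close> by (intro nn_integral_cong) (simp add: ennreal_mult [symmetric])
  also have "\<dots> = ennreal (1 / P) * (\<integral>\<^sup>+w. ennreal (f (exp w)) * ennreal (k (ln c - w)) \<partial>lborel)"
    by (rule nn_integral_cmult) simp
  also have "(\<integral>\<^sup>+w. ennreal (f (exp w)) * ennreal (k (ln c - w)) \<partial>lborel) =
      (\<integral>\<^sup>+v. ennreal (f (exp (ln c - v))) * ennreal (k v) \<partial>lborel)"
    by (subst nn_integral_reflect [where u = "ln c", symmetric]) simp_all
  finally show ?thesis by (simp add: K P_def)
qed

lemma recip_gamma_conv_nonneg: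
  assumes "ms \<noteq> []" "\<forall>m\<in>set ms. 0 < m" "0 < x" "0 < t"
  shows "0 \<le> recip_gamma_conv ms x t"
proof -
  obtain k where "\<And>u. 0 \<le> k u"
    and "\<And>x t. 0 < x \<Longrightarrow> 0 < t \<Longrightarrow>
      recip_gamma_conv ms x t = k (ln t - ln x) / (x * prod_list (map Gamma ms))"
    using recip_gamma_conv_log_form [OF assms(1,2)] by metis
  then show ?thesis
    using prod_list_Gamma_pos [OF assms(2)] assms(3,4) by simp
qed

lemma continuous_on_recip_gamma_conv:
  assumes "ms \<noteq> []" "\<forall>m\<in>set ms. 0 < m" "0 < t"
  shows "continuous_on {0<..} (\<lambda>x. recip_gamma_conv ms x t)"
proof -
  obtain k where k: "continuous_on UNIV k"
    and eq: "\<And>x t. 0 < x \<Longrightarrow> 0 < t \<Longrightarrow>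
      recip_gamma_conv ms x t = k (ln t - ln x) / (x * prod_list (map Gamma ms))"
    using recip_gamma_conv_log_form [OF assms(1,2)] by metis
  have "prod_list (map Gamma ms) > 0"
    using assms(2) by (rule prod_list_Gamma_pos)
  then have "continuous_on {0<..} (\<lambda>x. k (ln t - ln x) / (x * prod_list (map Gamma ms)))"
    by (intro continuous_intros continuous_on_compose2 [OF k]) auto
  then show ?thesis
    by (rule continuous_on_cong [THEN iffD1, rotated 2]) (simp_all add: eq assms)
qed

lemma prob_space_recip_gamma_conv:
  assumes ms: "ms \<noteq> []" "\<forall>m\<in>set ms. 0 < m" and "0 < t"
  shows "prob_space (density lborel (\<lambda>x. ennreal (indicator {0<..} x * recip_gamma_conv ms x t)))"
proof -
  have [measurable]: "(\<lambda>x. indicator {0<..} x * recip_gamma_conv ms x t) \<in> borel_measurable borel"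
    using continuous_on_recip_gamma_conv [OF assms]
    by (rule borel_measurable_continuous_on_indicator [rotated, where 'b = real, simplified]) simp
  obtain m ms' where Cons: "ms = m # ms'" using ms(1) by (cases ms) auto
  define P where "P = prod_list (map Gamma ms)"
  have "0 < P" unfolding P_def using ms(2) by (rule prod_list_Gamma_pos)
  have "(\<integral>\<^sup>+v. log_gamma_conv (\<lambda>u. ennreal (log_gamma (hd ms) u)) (tl ms) v \<partial>lborel) = ennreal P"
    using ms Cons by (simp add: P_def nn_integral_log_gamma_conv)
  then have "(\<integral>\<^sup>+x. ennreal (indicator {0<..} x * recip_gamma_conv ms x t) \<partial>lborel) =
      ennreal (1 / P) * ennreal P"
    using nn_integral_recip_gamma_conv [OF assms, of "\<lambda>_. 1"] by (simp add: P_def)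
  then show ?thesis
    using \<open>0 < P\<close> by (intro prob_spaceI) (simp add: emeasure_density ennreal_mult [symmetric])
qed

section \<open>The Laplace transform of the Mellin convolution\<close>

text \<open>With x = c exp (- v) the kernel exp (- l x) is \<open>log_gamma 0\<close> at ln l + ln c
  - v. The Laplace transform is therefore the full convolution, with exponent 0 put in front,
  evaluated at ln l + ln c.\<close>

lemma laplace_recip_gamma_conv:
  assumes n: "n \<ge> 1" and \<nu>: "\<nu> = 1 / (real n + 1)" and ms: "ms = map (\<lambda>j. real j * \<nu>) [1..<n + 1]"
    and "0 < l" "0 < t"
  shows "(\<integral>\<^sup>+x. ennreal (indicator {0<..} x * (exp (- l * x) * recip_gamma_conv ms x (\<phi> (n + 1) t))) \<partial>lborel) =
    ennreal (exp (- t * l powr \<nu>))"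
proof -
  have "0 < \<nu>" using \<nu> by simp
  then have pos: "\<forall>m\<in>set ms. 0 < m" using ms by auto
  obtain m ms' where Cons: "ms = m # ms'" using n ms by (simp add: upt_rec)
  define P where "P = prod_list (map Gamma ms)"
  have "0 < P" unfolding P_def using pos by (rule prod_list_Gamma_pos)
  define c where "c = \<phi> (n + 1) t"
  have "0 < c" using \<open>0 < t\<close> by (simp add: c_def \<phi>_def)
  let ?K = "log_gamma_conv (\<lambda>u. ennreal (log_gamma (hd ms) u)) (tl ms)"
  have "(\<integral>\<^sup>+x. ennreal (indicator {0<..} x * (exp (- l * x) * recip_gamma_conv ms x c)) \<partial>lborel) =
      ennreal (1 / P) * (\<integral>\<^sup>+v. ennreal (exp (- l * exp (ln c - v))) * ?K v \<partial>lborel)"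
    unfolding P_def by (rule nn_integral_recip_gamma_conv) (use Cons pos \<open>0 < c\<close> in simp_all)
  also have "(\<integral>\<^sup>+v. ennreal (exp (- l * exp (ln c - v))) * ?K v \<partial>lborel) =
      nn_conv (\<lambda>u. ennreal (log_gamma 0 u)) ?K (ln l + ln c)"
    unfolding nn_conv_def log_gamma_def using \<open>0 < l\<close>
    by (intro nn_integral_cong) (simp add: exp_add exp_diff)
  also have "\<dots> = log_gamma_conv (\<lambda>u. ennreal (log_gamma 0 u)) ms (ln l + ln c)"
    by (simp add: Cons log_gamma_conv_nn_conv)
  also have "\<dots> = ennreal (P * exp (- exp (\<nu> * (ln l + ln c)) / \<nu>))"
    unfolding P_def by (rule log_gamma_conv_closed_form [OF n \<nu> ms])
  \<comment> \<open>The time change enters here: c = (t / (n + 1))^(n + 1) has c powr \<nu> = t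
    \<nu>, which cancels the division by \<nu>.\<close>
  also have "- exp (\<nu> * (ln l + ln c)) / \<nu> = - t * l powr \<nu>"
  proof -
    have "ln c = real (n + 1) * ln (t / real (n + 1))"
      unfolding c_def \<phi>_def by (rule ln_realpow)
    then have "\<nu> * ln c = ln (t / (real n + 1))"
      using \<nu> by (simp add: add.commute)
    then have "exp (\<nu> * (ln l + ln c)) = l powr \<nu> * (t / (real n + 1))"
      using \<open>0 < t\<close> \<open>0 < l\<close> by (simp add: distrib_left exp_add powr_def)
    also have "t / (real n + 1) = t * \<nu>"
      using \<nu> by simp
    finally show ?thesis using \<open>0 < \<nu>\<close> by simp
  qed
  finally show ?thesis
    using \<open>0 < P\<close> by (simp add: c_def ennreal_mult [symmetric])
qed


section \<open>Uniqueness of the Laplace transform\<close>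

text \<open>Substituting \<open>y = exp (- x)\<close> turns the Laplace transform at the natural numbers into the
  moments of a distribution on \<open>[0, 1]\<close>, which the Weierstrass theorem shows to be determinate.\<close>
lemma laplace_transform_unique:
  fixes M N :: "real measure"
  assumes M: "real_distribution M" "AE x in M. 0 \<le> x"
    and N: "real_distribution N" "AE x in N. 0 \<le> x"
    and laplace: "\<And>l. 0 < l \<Longrightarrow> (\<integral>x. exp (- l * x) \<partial>M) = (\<integral>x. exp (- l * x) \<partial>N)"
  shows "M = N"
proof -
  \<comment> \<open>The i-th moment is the Laplace transform at l = i; for i = 0, which lies outside
    the hypothesis, both sides are the total mass 1.\<close>
  have moments: "(\<integral>x. exp (- x) ^ i \<partial>M) = (\<integral>x. exp (- x) ^ i \<partial>N)" for i
  proof (cases "i = 0")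
    case True
    then show ?thesis
      using M(1) N(1) by (simp add: real_distribution_def prob_space.prob_space)
  next
    case False
    then show ?thesis
      using laplace [of "real i"] by (simp add: exp_of_nat_mult [symmetric])
  qed
  have int: "integrable D (\<lambda>x. g (exp (- x)))"
    if "real_distribution D" "AE x in D. 0 \<le> x" "continuous_on UNIV g" for D and g :: "real \<Rightarrow> real"
  proof -
    interpret D: real_distribution D by fact
    have [measurable]: "g \<in> borel_measurable borel"
      using that(3) by (rule borel_measurable_continuous_onI)
    have "bounded (g ` {0..1})"
      by (intro compact_imp_bounded compact_continuous_image continuous_on_subset [OF that(3)]) auto
    then obtain B where "\<And>y. y \<in> {0..1} \<Longrightarrow> norm (g y) \<le> B"
      by (metis bounded_iff imageI)
    then have "AE x in D. norm (g (exp (- x))) \<le> B"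
      using that(2) by (auto elim!: eventually_mono)
    then show ?thesis
      by (intro D.integrable_const_bound) simp_all
  qed
  have approx: "\<bar>(\<integral>x. f (exp (- x)) \<partial>D) - (\<integral>x. g (exp (- x)) \<partial>D)\<bar> \<le> e"
    if D: "real_distribution D" "AE x in D. 0 \<le> x"
      and f: "continuous_on UNIV f" and g: "continuous_on UNIV g"
      and le: "\<And>y. y \<in> {0..1} \<Longrightarrow> \<bar>f y - g y\<bar> < e"
    for D and f g :: "real \<Rightarrow> real" and e
  proof -
    interpret D: real_distribution D by fact
    have "AE x in D. \<bar>f (exp (- x)) - g (exp (- x))\<bar> \<le> e"
      using D(2) le by (auto elim!: eventually_mono intro: less_imp_le)
    then have "(\<integral>x. \<bar>f (exp (- x)) - g (exp (- x))\<bar> \<partial>D) \<le> (\<integral>x. e \<partial>D)"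
      using int [OF D f] int [OF D g] by (intro integral_mono_AE) auto
    moreover have "\<bar>\<integral>x. f (exp (- x)) - g (exp (- x)) \<partial>D\<bar> \<le> (\<integral>x. \<bar>f (exp (- x)) - g (exp (- x))\<bar> \<partial>D)"
      by (rule integral_abs_bound)
    ultimately show ?thesis
      using int [OF D f] int [OF D g] D.prob_space by (simp del: D.space_eq_univ)
  qed
  have eq: "(\<integral>x. f (exp (- x)) \<partial>M) = (\<integral>x. f (exp (- x)) \<partial>N)"
    if f: "continuous_on UNIV f" for f :: "real \<Rightarrow> real"
  proof -
    \<comment> \<open>The summand 0 gives the bound the shape that \<open>field_le_epsilon\<close>
      expects.\<close>
    have "\<bar>(\<integral>x. f (exp (- x)) \<partial>M) - (\<integral>x. f (exp (- x)) \<partial>N)\<bar> \<le> 0 + e" if "0 < e" for e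
    proof -
      obtain g where g: "real_polynomial_function g" "\<And>y. y \<in> {0..1} \<Longrightarrow> \<bar>f y - g y\<bar> < e / 2"
        using Stone_Weierstrass_real_polynomial_function
          [of "{0..1::real}" f "e / 2"] \<open>0 < e\<close> continuous_on_subset [OF f] by (metis compact_Icc half_gt_zero subset_UNIV)
      obtain a n where gn: "g = (\<lambda>y. \<Sum>i\<le>n. a i * y ^ i)"
        using g(1) real_polynomial_function_iff_sum by blast
      have gc: "continuous_on UNIV g" unfolding gn by (intro continuous_intros)
      have "(\<integral>x. g (exp (- x)) \<partial>D) = (\<Sum>i\<le>n. a i * (\<integral>x. exp (- x) ^ i \<partial>D))"
        if "real_distribution D" "AE x in D. 0 \<le> x" for D
      proof -
        have "integrable D (\<lambda>x. exp (- x) ^ i)" for i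
          by (rule int [OF that]) (intro continuous_intros)
        then show ?thesis unfolding gn by (subst Bochner_Integration.integral_sum) auto
      qed
      then have "(\<integral>x. g (exp (- x)) \<partial>M) = (\<integral>x. g (exp (- x)) \<partial>N)"
        using M N moments by simp
      then show ?thesis
        using approx [OF M f gc g(2)] approx [OF N f gc g(2)] by linarith
    qed
    then show ?thesis
      by (metis abs_le_zero_iff eq_iff_diff_eq_0 field_le_epsilon)
  qed
  have rv: "(\<lambda>x. exp (- x)) \<in> borel_measurable D" "sets D = sets borel" "space D = UNIV"
    "real_distribution (distr D borel (\<lambda>x. exp (- x)))" if "real_distribution D" for D
  proof -
    interpret D: real_distribution D by fact
    show "(\<lambda>x. exp (- x)) \<in> borel_measurable D" "sets D = sets borel" "space D = UNIV"
      by simp_all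
    then show "real_distribution (distr D borel (\<lambda>x. exp (- x)))"
      by (intro D.real_distribution_distr)
  qed
  \<comment> \<open>The real and imaginary parts are integrals of cos (t y) and sin (t y) at y = exp
    (- x), hence covered by the equality for continuous test functions.\<close>
  have char: "char (distr D borel (\<lambda>x. exp (- x))) t =
      Complex (\<integral>x. cos (t * exp (- x)) \<partial>D) (\<integral>x. sin (t * exp (- x)) \<partial>D)"
    if D: "real_distribution D" for D t
  proof -
    interpret D: real_distribution D by fact
    have "char (distr D borel (\<lambda>x. exp (- x))) t = (CLINT x|D. iexp (t * exp (- x)))"
      unfolding char_def by (rule integral_distr) simp_all
    moreover have "complex_integrable D (\<lambda>x. iexp (t * exp (- x)))"
      by (intro D.integrable_const_bound [where B = 1]) simp_all
    ultimately show ?thesis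
      by (intro complex_eqI) (simp_all add: integral_Re [symmetric] integral_Im [symmetric] Re_exp Im_exp
          del: integral_Re integral_Im)
  qed
  have "char (distr M borel (\<lambda>x. exp (- x))) = char (distr N borel (\<lambda>x. exp (- x)))"
  proof
    fix t :: real
    have "(\<integral>x. cos (t * exp (- x)) \<partial>M) = (\<integral>x. cos (t * exp (- x)) \<partial>N)"
      by (rule eq) (intro continuous_intros)
    moreover have "(\<integral>x. sin (t * exp (- x)) \<partial>M) = (\<integral>x. sin (t * exp (- x)) \<partial>N)"
      by (rule eq) (intro continuous_intros)
    ultimately show "char (distr M borel (\<lambda>x. exp (- x))) t = char (distr N borel (\<lambda>x. exp (- x))) t"
      by (simp only: char M N)
  qed
  then have eq: "distr M borel (\<lambda>x. exp (- x)) = distr N borel (\<lambda>x. exp (- x))"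
    using M N rv by (intro Levy_uniqueness)
  \<comment> \<open>The map x to exp (- x) is undone by - ln, so equality of the image laws gives
    equality of the laws themselves.\<close>
  have inv: "distr (distr D borel (\<lambda>x. exp (- x))) borel (\<lambda>y. - ln y) = D" if "real_distribution D" for D
    using rv [OF that] by (simp add: distr_distr comp_def distr_id2)
  show ?thesis
    using inv [OF M(1)] inv [OF N(1)] unfolding eq by simp
qed

section \<open>Continuous densities and the law of the stable subordinator\<close>

text \<open>Densities of one law agree almost everywhere, and an open set of disagreement that is
  null must be empty.\<close>

lemma continuous_density_unique:
  assumes "prob_space M" and f: "continuous_density M Y f" and g: "continuous_density M Y g" and "0 < x"
  shows "f x = g x"
proof -
  interpret prob_space M by fact
  have cont: "continuous_on {0<..} f" "continuous_on {0<..} g"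
    and nonneg: "\<And>x. 0 < x \<Longrightarrow> 0 \<le> f x" "\<And>x. 0 < x \<Longrightarrow> 0 \<le> g x"
    using f g by (auto simp: continuous_density_def)
  have "AE x in lborel. ennreal (indicator {0<..} x * f x) = ennreal (indicator {0<..} x * g x)"
    using f g by (intro distributed_unique) (auto simp: continuous_density_def)
  then have "AE x in lborel. 0 < x \<longrightarrow> f x = g x"
    by eventually_elim (use nonneg in auto)
  then have "AE x in lebesgue. 0 < x \<longrightarrow> f x = g x"
    by (rule AE_completion)
  \<comment> \<open>Continuity is known on the positive half-line only; adjoining
    \<open>{..0}\<close> makes the set of agreement closed in the whole line.\<close>
  then have *: "AE x \<in> {0<..} in lebesgue. x \<in> {..0} \<union> {x \<in> {0<..}. f x = g x}"
    by eventually_elim auto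
  have "open ({0<..} \<inter> (\<lambda>x. f x - g x) -` (- {0}))"
    by (intro continuous_open_preimage continuous_on_diff cont) auto
  moreover have "{..0} \<union> {x \<in> {0<..}. f x = g x} = - ({0<..} \<inter> (\<lambda>x. f x - g x) -` (- {0}))"
    by auto
  ultimately have "closed ({..0} \<union> {x \<in> {0<..}. f x = g x})"
    by (simp only: closed_Compl)
  then have "x \<in> {..0} \<union> {x \<in> {0<..}. f x = g x}"
    by (rule mem_closed_if_AE_lebesgue_open [OF _ _ *, rotated]) (use \<open>0 < x\<close> in auto)
  then show ?thesis using \<open>0 < x\<close> by simp
qed

text \<open>Both laws are carried by [0, \<infinity>) and have the Laplace transform exp (- t l powr
  \<nu>), so \<open>laplace_transform_unique\<close> identifies them.\<close>

lemma continuous_density_stable_subordinator: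
  assumes n: "n \<ge> 1" and \<nu>: "\<nu> = 1 / (real n + 1)" and ms: "ms = map (\<lambda>j. real j * \<nu>) [1..<n + 1]"
    and "stable_subordinator M \<tau> \<nu>" and "0 < t"
  shows "continuous_density M (\<tau> t) (\<lambda>x. recip_gamma_conv ms x (\<phi> (n + 1) t))"
proof -
  interpret stable_subordinator M \<tau> \<nu> by fact
  have ms_ne: "ms \<noteq> []" using n ms by simp
  have pos: "\<forall>m\<in>set ms. 0 < m" using index(1) ms by auto
  define c where "c = \<phi> (n + 1) t"
  have c: "0 < c" using \<open>0 < t\<close> by (simp add: c_def \<phi>_def)
  define f where "f x = indicator {0<..} x * recip_gamma_conv ms x c" for x
  have f: "0 \<le> f x" for x
    using recip_gamma_conv_nonneg [OF ms_ne pos _ c, of x] by (simp add: f_def split: split_indicator)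
  have [measurable]: "f \<in> borel_measurable borel"
    unfolding f_def using continuous_on_recip_gamma_conv [OF ms_ne pos c]
    by (rule borel_measurable_continuous_on_indicator [rotated, where 'b = real, simplified]) simp
  have \<tau> [measurable]: "\<tau> t \<in> borel_measurable M"
    using random_variable_at \<open>0 < t\<close> by simp
  have "distr M borel (\<tau> t) = density lborel (\<lambda>x. ennreal (f x))"
  proof (rule laplace_transform_unique)
    show "real_distribution (distr M borel (\<tau> t))"
      using \<tau> by (rule real_distribution_distr)
    \<comment> \<open>Nonnegativity comes from the start at 0 and the monotone paths.\<close>
    have "AE w in M. 0 \<le> \<tau> t w"
      using nondecreasing start_zero
      by eventually_elim (use \<open>0 < t\<close> in \<open>metis less_imp_le order_refl\<close>)
    then show "AE x in distr M borel (\<tau> t). 0 \<le> x"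
      by (subst AE_distr_iff) simp_all
    have "prob_space (density lborel (\<lambda>x. ennreal (f x)))"
      unfolding f_def by (rule prob_space_recip_gamma_conv [OF ms_ne pos c])
    then show "real_distribution (density lborel (\<lambda>x. ennreal (f x)))"
      by (simp add: real_distribution_def real_distribution_axioms_def)
    show "AE x in density lborel (\<lambda>x. ennreal (f x)). 0 \<le> x"
      by (subst AE_density, simp) (auto simp: f_def split: split_indicator)
    fix l :: real assume "0 < l"
    have "(\<integral>x. exp (- l * x) \<partial>density lborel (\<lambda>x. ennreal (f x))) = (\<integral>x. f x * exp (- l * x) \<partial>lborel)"
      using f by (subst integral_real_density) simp_all
    also have "\<dots> = enn2real (\<integral>\<^sup>+x. ennreal (f x * exp (- l * x)) \<partial>lborel)"
      using f by (intro integral_eq_nn_integral) simp_all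
    also have "\<dots> = exp (- t * l powr \<nu>)"
      using laplace_recip_gamma_conv [OF n \<nu> ms \<open>0 < l\<close> \<open>0 < t\<close>]
      by (simp add: f_def c_def mult_ac)
    also have "\<dots> = (\<integral>x. exp (- l * x) \<partial>distr M borel (\<tau> t))"
      using laplace_transform [OF \<open>0 < t\<close> \<open>0 < l\<close>] by (subst integral_distr) simp_all
    finally show "(\<integral>x. exp (- l * x) \<partial>distr M borel (\<tau> t)) =
        (\<integral>x. exp (- l * x) \<partial>density lborel (\<lambda>x. ennreal (f x)))" ..
  qed
  then have "distributed M lborel (\<tau> t) (\<lambda>x. ennreal (f x))"
    by (simp add: distributed_def cong: distr_cong)
  then show ?thesis
    using recip_gamma_conv_nonneg [OF ms_ne pos _ c] continuous_on_recip_gamma_conv [OF ms_ne pos c]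
    by (simp add: continuous_density_def f_def c_def)
qed

text \<open>The first conjunct exhibits a family of continuous densities, so the second, which
  speaks of every such family, is not vacuous.\<close>

theorem lemma2:
  fixes n :: nat and \<nu> :: real and \<mu>s :: "real list"
    and M :: "'w measure" and \<tau> :: "real \<Rightarrow> 'w \<Rightarrow> real"
  assumes "n \<ge> 1"
    and "\<nu> = 1 / (real n + 1)"
    and "\<mu>s = map (\<lambda>j. real j * \<nu>) [1..<n + 1]"
    and "stable_subordinator M \<tau> \<nu>"
  shows "(\<forall>t>0. continuous_density M (\<tau> t) (\<lambda>x. recip_gamma_conv \<mu>s x (\<phi> (n + 1) t))) \<and>
    (\<forall>h :: real \<Rightarrow> real \<Rightarrow> real.
       (\<forall>t>0. continuous_density M (\<tau> t) (\<lambda>x. h x t)) \<longrightarrow>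
       (\<forall>x>0. \<forall>t>0. h x t = recip_gamma_conv \<mu>s x (\<phi> (n + 1) t)))"
proof -
  interpret stable_subordinator M \<tau> \<nu> by fact
  show ?thesis
    using continuous_density_stable_subordinator [OF assms]
      continuous_density_unique [OF prob_space_axioms] by blast
qed

end
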